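(* Let $f:\mathbb{F}_2^n\to\mathbb{F}_2$. Then $f$ cannot be both $\wedge$-decomposable and $\vee$-decomposable.
   Context: For a symmetric operation $\odot$ on arbitrarily many inputs, $f(x_1,\dots,x_n)$ is $\odot$-decomposable if there is a partition $\{x_1,\dots,x_n\}=\bigcup_{i=1}^t X_i$ with $t>1$, all $X_i$ nonempty and pairwise disjoint, and functions $f_i$ such that $f=\bigodot_{i=1}^t f_i(X_i)$. Standing assumption: $f$ depends on all of its $n$ variables. *)

theory Defs
  imports "HOL-Library.Z2" "HOL-Library.Disjoint_Sets" "HOL-Library.Multiset" "HOL-Library.FuncSet"
begin

text \<open>
  The field \<open>F\<^sub>2\<close> is the library type \<^typ>\<open>bit\<close>. The variables are indexed by \<open>{1..n}\<close>, and an
  assignment to a set of variables is an extensional function on it, so that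
  \<^term>\<open>restrict x X\<close> is the tuple of those inputs whose index lies in \<open>X\<close>.
\<close>

definition assignments :: "nat set \<Rightarrow> (nat \<Rightarrow> bit) set" where
  "assignments X = X \<rightarrow>\<^sub>E UNIV"

definition depends_on_all :: "nat \<Rightarrow> ((nat \<Rightarrow> bit) \<Rightarrow> bit) \<Rightarrow> bool" where
  "depends_on_all n f \<longleftrightarrow>
     (\<forall>i\<in>{1..n}. \<exists>x\<in>assignments {1..n}. \<exists>y\<in>assignments {1..n}.
        (\<forall>j\<in>{1..n}. j \<noteq> i \<longrightarrow> x j = y j) \<and> f x \<noteq> f y)"

text \<open>A symmetric operation on arbitrarily many inputs is a function of the multiset of inputs.\<close>

definition decomposable ::
    "(bit multiset \<Rightarrow> bit) \<Rightarrow> nat \<Rightarrow> ((nat \<Rightarrow> bit) \<Rightarrow> bit) \<Rightarrow> bool" where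
  "decomposable bigop n f \<longleftrightarrow>
     (\<exists>(t::nat) (X :: nat \<Rightarrow> nat set) (g :: nat \<Rightarrow> (nat \<Rightarrow> bit) \<Rightarrow> bit).
        t > 1 \<and>
        (\<forall>i\<in>{1..t}. X i \<noteq> {}) \<and>
        disjoint_family_on X {1..t} \<and>
        (\<Union>i\<in>{1..t}. X i) = {1..n} \<and>
        (\<forall>x\<in>assignments {1..n}.
           f x = bigop {# g i (restrict x (X i)). i \<in># mset_set {1..t} #}))"

context
  includes bit_operations_syntax
begin

definition big_and :: "bit multiset \<Rightarrow> bit" where
  "big_and M = fold_mset (AND) 1 M"

definition big_or :: "bit multiset \<Rightarrow> bit" where
  "big_or M = fold_mset (OR) 0 M"

lemma comp_fun_commute_and_bit: "comp_fun_commute ((AND) :: bit \<Rightarrow> bit \<Rightarrow> bit)"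
  by standard (simp add: fun_eq_iff ac_simps)

lemma comp_fun_commute_or_bit: "comp_fun_commute ((OR) :: bit \<Rightarrow> bit \<Rightarrow> bit)"
  by standard (simp add: fun_eq_iff ac_simps)

lemma big_and_empty [simp]: "big_and {#} = 1"
  by (simp add: big_and_def)

lemma big_and_add_mset [simp]: "big_and (add_mset b M) = b AND big_and M"
  by (simp add: big_and_def comp_fun_commute.fold_mset_add_mset[OF comp_fun_commute_and_bit])

lemma big_or_empty [simp]: "big_or {#} = 0"
  by (simp add: big_or_def)

lemma big_or_add_mset [simp]: "big_or (add_mset b M) = b OR big_or M"
  by (simp add: big_or_def comp_fun_commute.fold_mset_add_mset[OF comp_fun_commute_or_bit])

end

lemma big_and_eq_1_iff: "big_and M = 1 \<longleftrightarrow> (\<forall>b\<in>#M. b = 1)"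
  by (induction M) (auto simp: and_bit_def)

lemma big_or_eq_1_iff: "big_or M = 1 \<longleftrightarrow> (\<exists>b\<in>#M. b = 1)"
  by (induction M) (auto simp: or_bit_def)

end

theory Submission
  imports Defs
begin

text \<open>
  Group the parts of each decomposition into two blocks, so that
  \<open>f = P(A) \<and> Q(B) = R(C) \<or> S(D)\<close>. As \<open>f\<close> depends on all variables,
  there are assignments \<open>a\<close>, \<open>b\<close> with \<open>P(a) = 0\<close>, \<open>Q(b) = 0\<close> and \<open>c\<close>, \<open>d\<close> with
  \<open>R(c) = 1\<close>, \<open>S(d) = 1\<close>. Let \<open>w\<close> equal \<open>a\<close> on \<open>A \<inter> C\<close>, \<open>d\<close> on \<open>A \<inter> D\<close>, \<open>c\<close> on \<open>B \<inter> C\<close> and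
  \<open>b\<close> on \<open>B \<inter> D\<close>. Extending \<open>w\<close> on \<open>A\<close> by \<open>d\<close> on \<open>D\<close> makes \<open>f = 1\<close>, hence \<open>P(w) = 1\<close>; in the same
  way \<open>Q(w) = 1\<close>, \<open>R(w) = 0\<close> and \<open>S(w) = 0\<close>. So \<open>f(w)\<close> would be both \<open>1\<close> and \<open>0\<close>.
\<close>

lemma bit_eq_iff_if_neq: "a \<noteq> b \<Longrightarrow> a = c \<longleftrightarrow> b \<noteq> c" for a b c :: bit
  by (cases a; cases b; cases c) auto

text \<open>Replaces extensional assignments by total functions restricted only inside
  \<open>f\<close>, which can be glued freely. Both witnesses are \<open>undefined\<close> outside
  \<open>{1..n}\<close>, so they agree everywhere except possibly at \<open>i\<close>.\<close>

lemma depends_on_all_flip: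
  assumes "depends_on_all n f" "i \<in> {1..n}"
  obtains x y where "\<forall>j. j \<noteq> i \<longrightarrow> x j = y j"
    "f (restrict x {1..n}) \<noteq> f (restrict y {1..n})"
proof -
  from assms(1) have "\<exists>x\<in>assignments {1..n}. \<exists>y\<in>assignments {1..n}.
      (\<forall>j\<in>{1..n}. j \<noteq> i \<longrightarrow> x j = y j) \<and> f x \<noteq> f y"
    unfolding depends_on_all_def using assms(2) by (rule bspec)
  then obtain x y where x: "x \<in> assignments {1..n}" and y: "y \<in> assignments {1..n}"
    and eq: "\<forall>j\<in>{1..n}. j \<noteq> i \<longrightarrow> x j = y j" and neq: "f x \<noteq> f y"
    by (elim bexE conjE)
  have "x j = y j" if "j \<noteq> i" for j
  proof (cases "j \<in> {1..n}")
    case True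
    then show ?thesis using eq that by blast
  next
    case False
    then show ?thesis using x y unfolding assignments_def by (metis PiE_arb)
  qed
  moreover have "f (restrict x {1..n}) \<noteq> f (restrict y {1..n})"
    using x y neq by (simp add: assignments_def PiE_restrict)
  ultimately show thesis using that[of x y] by blast
qed

text \<open>The value \<open>c\<close> serves both operations by duality: \<open>c = 1\<close> for
  AND, \<open>c = 0\<close> for OR. \<open>P\<close> and \<open>Q\<close> can each fail, since
  otherwise \<open>f\<close> would ignore the variables of one block.\<close>

lemma decomposable_two_blocks:
  assumes op: "\<And>M. bigop M = c \<longleftrightarrow> (\<forall>b\<in>#M. b = c)"
    and dep: "depends_on_all n f" and dec: "decomposable bigop n f"
  obtains P Q A a b where
    "\<forall>x. f (restrict x {1..n}) = c \<longleftrightarrow> P x \<and> Q x"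
    "\<forall>x y. (\<forall>i. i \<in> A \<longrightarrow> x i = y i) \<longrightarrow> P x = P y"
    "\<forall>x y. (\<forall>i. i \<notin> A \<longrightarrow> x i = y i) \<longrightarrow> Q x = Q y"
    "\<not> P a" "\<not> Q b"
proof -
  from dec obtain t :: nat and X and g :: "nat \<Rightarrow> (nat \<Rightarrow> bit) \<Rightarrow> bit" where
    t: "t > 1" and ne: "\<forall>i\<in>{1..t}. X i \<noteq> {}" and
    disj: "disjoint_family_on X {1..t}" and un: "(\<Union>i\<in>{1..t}. X i) = {1..n}" and
    f: "\<forall>x\<in>assignments {1..n}.
          f x = bigop {# g i (restrict x (X i)). i \<in># mset_set {1..t} #}"
    unfolding decomposable_def by (elim exE conjE)
  \<comment> \<open>The first part is one block (\<open>A\<close> will be \<open>X 1\<close>); all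
    other parts are merged into the second.\<close>
  define P where "P x \<longleftrightarrow> g 1 (restrict x (X 1)) = c" for x
  define Q where "Q x \<longleftrightarrow> (\<forall>i\<in>{2..t}. g i (restrict x (X i)) = c)" for x
  have split: "{1..t} = insert 1 {2..t}" using t by auto
  have F: "f (restrict x {1..n}) = c \<longleftrightarrow> P x \<and> Q x" for x
  proof -
    have "restrict (restrict x {1..n}) (X i) = restrict x (X i)" if "i \<in> {1..t}" for i
    proof -
      have "X i \<subseteq> {1..n}" using un that by blast
      then show ?thesis by (simp add: Int_absorb1)
    qed
    moreover have "restrict x {1..n} \<in> assignments {1..n}"
      by (auto simp: assignments_def)
    ultimately have "f (restrict x {1..n}) = c \<longleftrightarrow> (\<forall>i\<in>{1..t}. g i (restrict x (X i)) = c)"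
      by (simp add: f op)
    then show ?thesis unfolding P_def Q_def split by blast
  qed
  have P: "P x = P y" if "\<And>i. i \<in> X 1 \<Longrightarrow> x i = y i" for x y
    using that unfolding P_def by (metis restrict_ext)
  have Q: "Q x = Q y" if xy: "\<And>i. i \<notin> X 1 \<Longrightarrow> x i = y i" for x y
  proof -
    have "restrict x (X i) = restrict y (X i)" if i: "i \<in> {2..t}" for i
    proof (rule restrict_ext)
      fix j assume j: "j \<in> X i"
      have "X i \<inter> X 1 = {}"
        using i by (intro disjoint_family_onD[OF disj]) auto
      with j show "x j = y j" using xy by blast
    qed
    then show ?thesis unfolding Q_def by simp
  qed
  have "\<exists>a. \<not> P a"
  proof (rule ccontr)
    assume "\<not> ?thesis"
    then have FQ: "f (restrict x {1..n}) = c \<longleftrightarrow> Q x" for x using F by blast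
    obtain i where i: "i \<in> X 1" "i \<in> {1..n}" using bspec[OF ne, of 1] un t by fastforce
    obtain x y where xy: "\<forall>j. j \<noteq> i \<longrightarrow> x j = y j"
      "f (restrict x {1..n}) \<noteq> f (restrict y {1..n})"
      by (rule depends_on_all_flip[OF dep i(2)])
    \<comment> \<open>\<open>Q\<close> does not see the change at \<open>i\<close>, yet of two
      distinct bits exactly one equals \<open>c\<close>.\<close>
    have "Q x = Q y" using xy(1) i(1) by (intro Q) auto
    then show False using FQ[of x] FQ[of y] bit_eq_iff_if_neq[OF xy(2)] by blast
  qed
  moreover have "\<exists>b. \<not> Q b"
  proof (rule ccontr)
    assume "\<not> ?thesis"
    then have FP: "f (restrict x {1..n}) = c \<longleftrightarrow> P x" for x using F by blast
    have "2 \<in> {1..t}" using t by simp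
    then obtain i where i: "i \<in> X 2" "i \<in> {1..n}" using bspec[OF ne, of 2] un by fastforce
    have "X 1 \<inter> X 2 = {}"
      using t by (intro disjoint_family_onD[OF disj]) auto
    then have "i \<notin> X 1" using i by blast
    obtain x y where xy: "\<forall>j. j \<noteq> i \<longrightarrow> x j = y j"
      "f (restrict x {1..n}) \<noteq> f (restrict y {1..n})"
      by (rule depends_on_all_flip[OF dep i(2)])
    have "P x = P y" using xy(1) \<open>i \<notin> X 1\<close> by (intro P) auto
    then show False using FP[of x] FP[of y] bit_eq_iff_if_neq[OF xy(2)] by blast
  qed
  ultimately obtain a b where "\<not> P a" "\<not> Q b" by blast
  then show thesis using F P Q by (intro that[of P Q "X 1" a b]) blast+
qed

lemma big_or_eq_0_iff: "big_or M = 0 \<longleftrightarrow> (\<forall>b\<in>#M. b = 0)"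
  by (induction M) (auto simp: or_bit_def)

theorem mainTheorem10:
  fixes n :: nat and f :: "(nat \<Rightarrow> bit) \<Rightarrow> bit"
  assumes "depends_on_all n f"
  shows "\<not> (decomposable big_and n f \<and> decomposable big_or n f)"
proof
  assume dec: "decomposable big_and n f \<and> decomposable big_or n f"
  let ?F = "\<lambda>x. f (restrict x {1..n})"
  obtain P Q A a b where PQ: "\<forall>x. ?F x = 1 \<longleftrightarrow> P x \<and> Q x"
    and P: "\<forall>x y. (\<forall>i. i \<in> A \<longrightarrow> x i = y i) \<longrightarrow> P x = P y"
    and Q: "\<forall>x y. (\<forall>i. i \<notin> A \<longrightarrow> x i = y i) \<longrightarrow> Q x = Q y"
    and ab: "\<not> P a" "\<not> Q b"
    by (rule decomposable_two_blocks[OF big_and_eq_1_iff assms conjunct1[OF dec]])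
  \<comment> \<open>Here \<open>R\<close> and \<open>S\<close> say that the two disjuncts vanish.\<close>
  obtain R S C c d where RS: "\<forall>x. ?F x = 0 \<longleftrightarrow> R x \<and> S x"
    and R: "\<forall>x y. (\<forall>i. i \<in> C \<longrightarrow> x i = y i) \<longrightarrow> R x = R y"
    and S: "\<forall>x y. (\<forall>i. i \<notin> C \<longrightarrow> x i = y i) \<longrightarrow> S x = S y"
    and cd: "\<not> R c" "\<not> S d"
    by (rule decomposable_two_blocks[OF big_or_eq_0_iff assms conjunct2[OF dec]])
  \<comment> \<open>A bit is either 1 or 0, so exactly one of the two conjunctions holds; refuting
    one conjunct of a pair yields the whole other pair.\<close>
  have excl: "(P x \<and> Q x) \<noteq> (R x \<and> S x)" for x
    using PQ[rule_format, of x] RS[rule_format, of x] by (cases "?F x") auto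
  define w where "w i = (if i \<in> A then if i \<in> C then a i else d i
                         else if i \<in> C then c i else b i)" for i
  have "P w"
  proof -
    \<comment> \<open>Off \<open>C\<close> this is \<open>d\<close> on both sides of
      \<open>A\<close>, so \<open>S\<close> fails and \<open>f\<close> is 1 here.\<close>
    let ?v = "\<lambda>i. if i \<in> A then w i else d i"
    have "S ?v = S d" by (rule S[rule_format]) (simp add: w_def)
    moreover have "P ?v = P w" by (rule P[rule_format]) simp
    ultimately show ?thesis using excl[of ?v] cd by blast
  qed
  moreover have "Q w"
  proof -
    let ?v = "\<lambda>i. if i \<in> A then c i else w i"
    have "R ?v = R c" by (rule R[rule_format]) (simp add: w_def)
    moreover have "Q ?v = Q w" by (rule Q[rule_format]) simp
    ultimately show ?thesis using excl[of ?v] cd by blast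
  qed
  moreover have "R w"
  proof -
    \<comment> \<open>Now the roles are exchanged: on \<open>A\<close> this is \<open>a\<close>, so
      \<open>P\<close> fails and \<open>f\<close> is 0 here.\<close>
    let ?v = "\<lambda>i. if i \<in> C then w i else a i"
    have "P ?v = P a" by (rule P[rule_format]) (simp add: w_def)
    moreover have "R ?v = R w" by (rule R[rule_format]) simp
    ultimately show ?thesis using excl[of ?v] ab by blast
  qed
  moreover have "S w"
  proof -
    let ?v = "\<lambda>i. if i \<in> C then b i else w i"
    have "Q ?v = Q b" by (rule Q[rule_format]) (simp add: w_def)
    moreover have "S ?v = S w" by (rule S[rule_format]) simp
    ultimately show ?thesis using excl[of ?v] ab by blast
  qed
  ultimately show False using excl[of w] by blast
qed

end
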